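(* Let $G$ be a connected graph with no isolated vertices, let $n=|V(G)|$, and let $k$ be an integer with $1\le k\le n$. Then $G$ is $(n-k)$-connected if and only if there exists $A\in\mathcal{S}(G)$ with $k=\operatorname{rank}(A)=\operatorname{spark}(A)-1$.
   Context: Graphs are finite, simple and undirected. For a graph $G$ with vertices $v_1,\dots,v_n$, $\mathcal{S}(G)$ is the set of real symmetric $n\times n$ matrices $A=[a_{ij}]$ such that for $i\neq j$, $a_{ij}\neq 0$ if and only if $v_iv_j$ is an edge of $G$ (diagonal entries are unrestricted). The spark of a real symmetric $n\times n$ matrix $A$, $\operatorname{spark}(A)$, is the smallest integer $s$ such that some $s$ columns of $A$ are linearly dependent (equivalently the minimum size of the support of a nonzero null vector of $A$); if $A$ is nonsingular, $\operatorname{spark}(A)=n+1$. The vertex connectivity $\kappa(G)$ is the minimum size of a set of vertices whose deletion disconnects $G$, with the convention $\kappa(K_n)=n-1$ for complete graphs. A graph is $m$-connected if $\kappa(G)\ge m$. *)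

theory Defs
  imports "HOL-Analysis.Analysis"
begin

text \<open>
  The vertices of a graph are all elements of a finite type \<open>'n\<close>, which also indexes the rows and
  columns of matrices; a graph is given by its adjacency relation.
\<close>

definition simple_graph :: "('n::finite \<Rightarrow> 'n \<Rightarrow> bool) \<Rightarrow> bool" where
  "simple_graph E \<longleftrightarrow> symp E \<and> irreflp E"

text \<open>
  Connectedness of the subgraph induced by \<open>W\<close>. The graph without vertices counts as connected,
  so deleting all vertices does not disconnect a graph.
\<close>

definition induced_connected :: "('n::finite \<Rightarrow> 'n \<Rightarrow> bool) \<Rightarrow> 'n set \<Rightarrow> bool" where
  "induced_connected E W \<longleftrightarrow>
     (\<forall>u\<in>W. \<forall>v\<in>W. (\<lambda>x y. x \<in> W \<and> y \<in> W \<and> E x y)\<^sup>*\<^sup>* u v)"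

definition connected_graph :: "('n::finite \<Rightarrow> 'n \<Rightarrow> bool) \<Rightarrow> bool" where
  "connected_graph E \<longleftrightarrow> induced_connected E UNIV"

definition isolated_vertex :: "('n::finite \<Rightarrow> 'n \<Rightarrow> bool) \<Rightarrow> 'n \<Rightarrow> bool" where
  "isolated_vertex E v \<longleftrightarrow> (\<forall>w. \<not> E v w)"

definition complete_graph :: "('n::finite \<Rightarrow> 'n \<Rightarrow> bool) \<Rightarrow> bool" where
  "complete_graph E \<longleftrightarrow> (\<forall>u v. u \<noteq> v \<longrightarrow> E u v)"

text \<open>
  In a graph that is not complete, deleting all vertices but two nonadjacent ones disconnects it,
  so the minimum below is over a nonempty set.
\<close>

definition vertex_connectivity :: "('n::finite \<Rightarrow> 'n \<Rightarrow> bool) \<Rightarrow> nat" where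
  "vertex_connectivity E =
     (if complete_graph E then CARD('n) - 1
      else LEAST m. \<exists>S. card S = m \<and> \<not> induced_connected E (UNIV - S))"

definition m_connected :: "nat \<Rightarrow> ('n::finite \<Rightarrow> 'n \<Rightarrow> bool) \<Rightarrow> bool" where
  "m_connected m E \<longleftrightarrow> vertex_connectivity E \<ge> m"

definition sym_matrices :: "('n::finite \<Rightarrow> 'n \<Rightarrow> bool) \<Rightarrow> (real^'n^'n) set" where
  "sym_matrices E =
     {A. transpose A = A \<and> (\<forall>i j. i \<noteq> j \<longrightarrow> (A $ i $ j \<noteq> 0 \<longleftrightarrow> E i j))}"

text \<open>
  Dependence of the columns as a family indexed by \<open>S\<close>: two equal columns at different indices
  are dependent, which \<^const>\<open>dependent\<close> applied to the set of columns would miss.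
\<close>

definition columns_dependent :: "real^'n^'n \<Rightarrow> 'n::finite set \<Rightarrow> bool" where
  "columns_dependent A S \<longleftrightarrow>
     (\<exists>c. (\<exists>j\<in>S. c j \<noteq> 0) \<and> (\<Sum>j\<in>S. c j *\<^sub>R column j A) = 0)"

definition spark :: "real^'n^'n \<Rightarrow> nat" where
  "spark (A :: real^'n^'n) =
     (if invertible A then CARD('n) + 1
      else LEAST s. \<exists>S. card S = s \<and> columns_dependent A S)"

end

theory Submission
  imports Defs
begin

text \<open>
  A disconnected induced subgraph on a set \<open>T\<close> of vertices is the same thing as a separating set
  \<open>UNIV - T\<close>, so being \<open>(n - k)\<close>-connected means that disconnected induced subgraphs have at most
  \<open>k\<close> vertices (\<open>m_connected_iff\<close>).

  \<^bold>\<open>From a matrix to connectivity.\<close> Let \<open>A\<close> have rank \<open>k\<close> and spark \<open>k + 1\<close>, and suppose that a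
  disconnected \<open>T\<close> has more than \<open>k\<close> vertices. Take \<open>k + 1\<close> of them that meet both sides of the
  disconnection. Their columns satisfy a linear relation with no zero coefficient. The part of the
  relation that belongs to one side is a vector in the column space that vanishes in all \<open>k + 1\<close>
  chosen rows; since \<open>k\<close> of these rows span the row space, that vector is zero, which is a
  dependence among at most \<open>k\<close> columns.

  \<^bold>\<open>From connectivity to a matrix.\<close> This is the theorem of Lovasz, Saks and Schrijver on
  orthogonal representations. Let \<open>U\<close> be a Euclidean space of dimension \<open>k\<close>. Vectors \<open>f v \<in> U\<close> such
  that \<open>f u\<close> and \<open>f v\<close> are orthogonal exactly when the distinct vertices \<open>u\<close>, \<open>v\<close> are nonadjacent,
  and such that any \<open>k\<close> of them are independent, have a Gram matrix with the required properties
  (\<open>exists_matrix_if_connected\<close>). To find them, order the vertices and call an orthogonal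
  representation regular for the order if for every vertex the vectors of its earlier nonneighbours
  are independent. Then the admissible choices for a vector, given the earlier ones, form a space
  that varies continuously, so approximations of a regular representation of an initial segment
  extend to approximations of the whole (\<open>extend_approximation\<close>).

  Everything rests on the fact that the closure of the set of regular representations does not
  depend on the order (\<open>closure_regular_reps_perm\<close>). By induction, and by the extension property,
  this closure depends only on the last vertex of the order. Adjacent vertices can
  be exchanged at the end of the order, so the closure is the same for both of them as last vertex,
  and if the graph is connected, then it is the same for all vertices. The induction
  applies this to induced subgraphs: those with more than \<open>k\<close> vertices are connected, and for those
  with at most \<open>k\<close> vertices the representations by independent vectors are dense
  in the regular ones for every order (\<open>approximate_by_independent\<close>).

  A given set of at most \<open>k\<close> vertices can now be moved to the front of the order, which shows that
  independence of its vectors is an open dense condition; from this, so is nonorthogonality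
  on a given edge. Finitely many open dense conditions on a nonempty set hold simultaneously
  somewhere. Closures of sets of representations thus replace the probability distributions of the
  original argument.
\<close>

section \<open>Independent families\<close>

text \<open>
  Independence is a property of the indexed family here, as in \<^const>\<open>columns_dependent\<close>: a repeated
  vector makes the family dependent.
\<close>

definition independent_family :: "('i \<Rightarrow> 'a::real_vector) \<Rightarrow> 'i set \<Rightarrow> bool" where
  "independent_family f J \<longleftrightarrow> (\<forall>c. (\<Sum>j\<in>J. c j *\<^sub>R f j) = 0 \<longrightarrow> (\<forall>j\<in>J. c j = 0))"

lemma independent_familyD:
  "independent_family f J \<Longrightarrow> (\<Sum>j\<in>J. c j *\<^sub>R f j) = 0 \<Longrightarrow> j \<in> J \<Longrightarrow> c j = 0"
  by (auto simp: independent_family_def)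

lemma independent_family_cong:
  "(\<And>j. j \<in> J \<Longrightarrow> f j = g j) \<Longrightarrow> independent_family f J = independent_family g J"
  by (simp add: independent_family_def)

lemma independent_family_mono:
  assumes "independent_family f J" "I \<subseteq> J" "finite J"
  shows "independent_family f I"
  unfolding independent_family_def
proof (intro allI impI ballI)
  fix c j assume c: "(\<Sum>j\<in>I. c j *\<^sub>R f j) = 0" and j: "j \<in> I"
  have "(\<Sum>j\<in>J. (if j \<in> I then c j else 0) *\<^sub>R f j) = (\<Sum>j\<in>I. c j *\<^sub>R f j)"
    using assms(2,3) by (intro sum.mono_neutral_cong_right) auto
  with c independent_familyD[OF assms(1), of "\<lambda>j. if j \<in> I then c j else 0" j] j assms(2)
  show "c j = 0" by auto
qed

lemma independent_family_imp_independent: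
  assumes "independent_family f J" "finite J"
  shows "inj_on f J" "independent (f ` J)"
proof -
  show inj: "inj_on f J"
  proof (rule inj_onI, rule ccontr)
    fix i j assume ij: "i \<in> J" "j \<in> J" "f i = f j" "i \<noteq> j"
    let ?c = "\<lambda>l. if l = i then 1 else if l = j then -1 else 0 :: real"
    have "(\<Sum>l\<in>J. ?c l *\<^sub>R f l) = (\<Sum>l\<in>{i,j}. ?c l *\<^sub>R f l)"
      using ij assms(2) by (intro sum.mono_neutral_right) auto
    also have "\<dots> = 0" using ij by simp
    finally show False using independent_familyD[OF assms(1), of ?c i] ij by simp
  qed
  show "independent (f ` J)"
  proof
    assume "dependent (f ` J)"
    then obtain u where u: "\<exists>v\<in>f ` J. u v \<noteq> 0" "(\<Sum>v\<in>f ` J. u v *\<^sub>R v) = 0"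
      using assms(2) by (auto simp: dependent_finite)
    have "(\<Sum>j\<in>J. u (f j) *\<^sub>R f j) = 0" using u(2) inj by (simp add: sum.reindex)
    then show False using independent_familyD[OF assms(1), of "\<lambda>j. u (f j)"] u(1) by auto
  qed
qed

lemma independent_family_insert:
  fixes f :: "'i \<Rightarrow> 'a::real_inner"
  assumes "independent_family f J" "finite J" "v \<notin> J"
    and "\<And>j. j \<in> J \<Longrightarrow> f j \<bullet> y = 0" "f v \<bullet> y \<noteq> 0"
  shows "independent_family f (insert v J)"
  unfolding independent_family_def
proof (intro allI impI)
  fix c assume c: "(\<Sum>j\<in>insert v J. c j *\<^sub>R f j) = 0"
  then have s: "c v *\<^sub>R f v + (\<Sum>j\<in>J. c j *\<^sub>R f j) = 0" using assms(2,3) by simp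
  then have "(c v *\<^sub>R f v + (\<Sum>j\<in>J. c j *\<^sub>R f j)) \<bullet> y = 0" by simp
  then have "c v = 0" using assms(4,5) by (simp add: inner_add_left inner_sum_left)
  then show "\<forall>j\<in>insert v J. c j = 0" using s independent_familyD[OF assms(1), of c] by auto
qed

text \<open>
  The map from coefficients to combinations is linear and injective on a finite-dimensional space,
  hence bounded below. The quantitative form is what survives a perturbation of the vectors.
\<close>

lemma independent_family_lower_bound:
  fixes f :: "'n::finite \<Rightarrow> 'a::euclidean_space"
  assumes "independent_family f J"
  obtains \<delta> where "\<delta> > 0" "\<And>c. \<delta> * (\<Sum>j\<in>J. \<bar>c j\<bar>) \<le> norm (\<Sum>j\<in>J. c j *\<^sub>R f j)"
proof -
  let ?S = "{c::real^'n. \<forall>j. j \<notin> J \<longrightarrow> c $ j = 0}"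
  let ?F = "\<lambda>c::real^'n. \<Sum>j\<in>J. c $ j *\<^sub>R f j"
  have S: "subspace ?S" by (auto simp: subspace_def)
  have F: "bounded_linear ?F"
    by (intro bounded_linear_sum bounded_linear_scaleR_const bounded_linear_vec_nth)
  have "\<forall>c\<in>?S. ?F c = 0 \<longrightarrow> c = 0"
    using independent_familyD[OF assms] by (fastforce simp: vec_eq_iff)
  from injective_imp_isometric[OF closed_subspace[OF S] S F this]
  obtain e where e: "e > 0" "\<And>c. c \<in> ?S \<Longrightarrow> e * norm c \<le> norm (?F c)" by auto
  show ?thesis
  proof
    show "e / (real (card J) + 1) > 0" using e(1) by simp
    fix c :: "'n \<Rightarrow> real"
    let ?c = "\<chi> j. if j \<in> J then c j else 0"
    have "(\<Sum>j\<in>J. \<bar>c j\<bar>) \<le> (\<Sum>j\<in>J. norm ?c)"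
    proof (rule sum_mono)
      fix j assume "j \<in> J"
      then show "\<bar>c j\<bar> \<le> norm ?c" using component_le_norm_cart[of ?c j] by simp
    qed
    also have "\<dots> \<le> (real (card J) + 1) * norm ?c" by (simp add: algebra_simps)
    finally have "e / (real (card J) + 1) * (\<Sum>j\<in>J. \<bar>c j\<bar>)
        \<le> e / (real (card J) + 1) * ((real (card J) + 1) * norm ?c)"
      using e(1) by (intro mult_left_mono) auto
    also have "\<dots> = e * norm ?c" by (simp add: add_pos_nonneg field_simps)
    also have "\<dots> \<le> norm (?F ?c)" by (intro e(2)) simp
    also have "?F ?c = (\<Sum>j\<in>J. c j *\<^sub>R f j)" by (intro sum.cong) auto
    finally show "e / (real (card J) + 1) * (\<Sum>j\<in>J. \<bar>c j\<bar>) \<le> norm (\<Sum>j\<in>J. c j *\<^sub>R f j)" .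
  qed
qed

lemma lower_bound_perturb:
  fixes f g :: "real^'m^'n::finite"
  assumes "\<And>c. \<delta> * (\<Sum>j\<in>J. \<bar>c j\<bar>) \<le> norm (\<Sum>j\<in>J. c j *\<^sub>R f $ j)"
    and "dist f g \<le> \<eta>"
  shows "(\<delta> - \<eta>) * (\<Sum>j\<in>J. \<bar>c j\<bar>) \<le> norm (\<Sum>j\<in>J. c j *\<^sub>R g $ j)"
proof -
  have "norm (\<Sum>j\<in>J. c j *\<^sub>R (f $ j - g $ j)) \<le> (\<Sum>j\<in>J. \<bar>c j\<bar> * \<eta>)"
  proof (rule sum_norm_le)
    fix j
    have "norm (f $ j - g $ j) \<le> \<eta>"
      using Finite_Cartesian_Product.norm_nth_le[of "f - g" j] assms(2) by (simp add: dist_norm)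
    then show "norm (c j *\<^sub>R (f $ j - g $ j)) \<le> \<bar>c j\<bar> * \<eta>"
      by (simp add: mult_left_mono)
  qed
  moreover have "norm (\<Sum>j\<in>J. c j *\<^sub>R f $ j)
      \<le> norm (\<Sum>j\<in>J. c j *\<^sub>R g $ j) + norm (\<Sum>j\<in>J. c j *\<^sub>R (f $ j - g $ j))"
    using norm_triangle_ineq[of "\<Sum>j\<in>J. c j *\<^sub>R g $ j" "\<Sum>j\<in>J. c j *\<^sub>R (f $ j - g $ j)"]
    by (simp add: sum.distrib[symmetric] scaleR_right_diff_distrib)
  moreover have "(\<Sum>j\<in>J. \<bar>c j\<bar> * \<eta>) = \<eta> * (\<Sum>j\<in>J. \<bar>c j\<bar>)"
    by (simp add: sum_distrib_left mult.commute)
  ultimately show ?thesis using assms(1)[of c] unfolding left_diff_distrib by linarith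
qed

lemma independent_family_if_lower_bound:
  fixes f :: "'i \<Rightarrow> 'a::real_normed_vector"
  assumes "\<delta> > 0" "finite J" "\<And>c. \<delta> * (\<Sum>j\<in>J. \<bar>c j\<bar>) \<le> norm (\<Sum>j\<in>J. c j *\<^sub>R f j)"
  shows "independent_family f J"
  unfolding independent_family_def
proof (intro allI impI)
  fix c assume "(\<Sum>j\<in>J. c j *\<^sub>R f j) = 0"
  with assms(3)[of c] have "\<delta> * (\<Sum>j\<in>J. \<bar>c j\<bar>) \<le> 0" by simp
  with assms(1) have "(\<Sum>j\<in>J. \<bar>c j\<bar>) \<le> 0" by (simp add: mult_le_0_iff)
  then have "(\<Sum>j\<in>J. \<bar>c j\<bar>) = 0" by (simp add: antisym sum_nonneg)
  then show "\<forall>j\<in>J. c j = 0" using assms(2) by (simp add: sum_nonneg_eq_0_iff)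
qed

lemma norm_axis: "norm (axis v x :: 'a::real_normed_vector^'n::finite) = norm x"
proof -
  have "(norm (axis v x $ i))\<^sup>2 = (if i = v then (norm x)\<^sup>2 else 0)" for i
    by (simp add: axis_def)
  then show ?thesis by (simp add: norm_vec_def L2_set_def)
qed

abbreviation rows_independent :: "real^'m^'n \<Rightarrow> 'n set \<Rightarrow> bool" where
  "rows_independent f J \<equiv> independent_family (\<lambda>j. f $ j) J"

lemma open_rows_independent: "open {f :: real^'m^'n::finite. rows_independent f J}"
  unfolding open_dist
proof (intro ballI, simp)
  fix f :: "real^'m^'n" assume "rows_independent f J"
  from independent_family_lower_bound[OF this]
  obtain \<delta> where d: "\<delta> > 0" "\<And>c. \<delta> * (\<Sum>j\<in>J. \<bar>c j\<bar>) \<le> norm (\<Sum>j\<in>J. c j *\<^sub>R f $ j)" by blast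
  show "\<exists>e>0. \<forall>g. dist g f < e \<longrightarrow> rows_independent g J"
  proof (intro exI conjI allI impI)
    show "\<delta> / 2 > 0" using d(1) by simp
    fix g assume "dist g f < \<delta> / 2"
    then have "dist f g \<le> \<delta> / 2" by (simp add: dist_commute)
    from lower_bound_perturb[OF d(2) this]
    show "rows_independent g J"
      by (intro independent_family_if_lower_bound[of "\<delta> - \<delta> / 2"]) (use d(1) in auto)
  qed
qed

text \<open>
  The coefficients are indexed by \<open>J\<close> even if \<open>f\<close> is not injective on it.
\<close>

lemma span_image_sum:
  assumes "p \<in> span (f ` J)" "finite J"
  obtains c where "p = (\<Sum>j\<in>J. c j *\<^sub>R f j)"
proof -
  have "span (f ` J) = range (\<lambda>c. \<Sum>j\<in>J. c j *\<^sub>R f j)"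
    using assms(2)
  proof (induction J)
    case (insert v J)
    show ?case
    proof
      show "span (f ` insert v J) \<subseteq> range (\<lambda>c. \<Sum>j\<in>insert v J. c j *\<^sub>R f j)"
      proof
        fix x assume "x \<in> span (f ` insert v J)"
        then obtain k where "x - k *\<^sub>R f v \<in> span (f ` J)" by (auto simp: span_insert)
        then obtain c where c: "x - k *\<^sub>R f v = (\<Sum>j\<in>J. c j *\<^sub>R f j)" using insert.IH by auto
        have "(\<Sum>j\<in>J. (c(v := k)) j *\<^sub>R f j) = (\<Sum>j\<in>J. c j *\<^sub>R f j)"
          using insert.hyps by (intro sum.cong) auto
        then have "x = (\<Sum>j\<in>insert v J. (c(v := k)) j *\<^sub>R f j)"
          using insert.hyps c by (simp add: algebra_simps)
        then show "x \<in> range (\<lambda>c. \<Sum>j\<in>insert v J. c j *\<^sub>R f j)" by blast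
      qed
      show "range (\<lambda>c. \<Sum>j\<in>insert v J. c j *\<^sub>R f j) \<subseteq> span (f ` insert v J)"
        by (rule image_subsetI, intro span_sum span_scale span_base) auto
    qed
  qed auto
  with assms(1) that show ?thesis by auto
qed

section \<open>Orthogonal representations\<close>

locale orthogonal_representation =
  fixes E :: "'n::finite \<Rightarrow> 'n \<Rightarrow> bool" and U :: "(real^'m) set"
  assumes sym: "symp E" and U: "subspace U"
begin

lemma E_sym: "E u v \<longleftrightarrow> E v u"
  using sym by (auto simp: symp_def)

text \<open>
  A representation assigns row \<open>v\<close> of a matrix to vertex \<open>v\<close>. Rows outside \<open>T\<close> are left
  arbitrary, so that representations of different induced subgraphs live in one space.
\<close>

definition ortho_reps :: "'n set \<Rightarrow> (real^'m^'n) set" where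
  "ortho_reps T = {f. (\<forall>v\<in>T. f $ v \<in> U) \<and>
     (\<forall>u\<in>T. \<forall>v\<in>T. u \<noteq> v \<longrightarrow> \<not> E u v \<longrightarrow> f $ u \<bullet> f $ v = 0)}"

definition nonneighbours :: "'n \<Rightarrow> 'n set \<Rightarrow> 'n set" where
  "nonneighbours v T = {w\<in>T. w \<noteq> v \<and> \<not> E v w}"

text \<open>
  A list stands for the order in which vectors are chosen, the last chosen vertex being the head.
\<close>

fun regular :: "'n list \<Rightarrow> (real^'m^'n) set" where
  "regular [] = UNIV"
| "regular (v # s) = regular s \<inter> {f. rows_independent f (nonneighbours v (set s))}"

definition regular_reps :: "'n list \<Rightarrow> (real^'m^'n) set" where
  "regular_reps s = ortho_reps (set s) \<inter> regular s"

lemma open_regular: "open (regular s)"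
  by (induction s) (auto intro!: open_Int open_rows_independent)

lemma regular_cong: "(\<And>v. v \<in> set s \<Longrightarrow> f $ v = g $ v) \<Longrightarrow> f \<in> regular s \<longleftrightarrow> g \<in> regular s"
proof (induction s)
  case (Cons v s)
  then have "rows_independent f (nonneighbours v (set s)) =
      rows_independent g (nonneighbours v (set s))"
    by (intro independent_family_cong) (auto simp: nonneighbours_def)
  with Cons show ?case by auto
qed auto

lemma ortho_reps_cong:
  "(\<And>v. v \<in> T \<Longrightarrow> f $ v = g $ v) \<Longrightarrow> f \<in> ortho_reps T \<longleftrightarrow> g \<in> ortho_reps T"
  by (auto simp: ortho_reps_def)

lemma ortho_reps_insert:
  "f \<in> ortho_reps (insert v T) \<longleftrightarrow>
     f \<in> ortho_reps T \<and> f $ v \<in> U \<and> (\<forall>w\<in>nonneighbours v T. f $ w \<bullet> f $ v = 0)"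
  by (auto simp: ortho_reps_def nonneighbours_def inner_commute E_sym)

lemma ortho_reps_U: "f \<in> ortho_reps T \<Longrightarrow> v \<in> T \<Longrightarrow> f $ v \<in> U"
  by (simp add: ortho_reps_def)

lemma span_rows_subset: "f \<in> ortho_reps T \<Longrightarrow> J \<subseteq> T \<Longrightarrow> span ((\<lambda>w. f $ w) ` J) \<subseteq> U"
  using U by (intro span_minimal) (auto simp: ortho_reps_def)

lemma regular_reps_Cons:
  "f \<in> regular_reps (v # s) \<longleftrightarrow>
     f \<in> regular_reps s \<and> f $ v \<in> U \<and> (\<forall>w\<in>nonneighbours v (set s). f $ w \<bullet> f $ v = 0) \<and>
     rows_independent f (nonneighbours v (set s))"
  by (auto simp: regular_reps_def ortho_reps_insert)

text \<open>
  Let \<open>g\<close> approximate \<open>f\<close> on the vertices before \<open>v\<close>. The vector of \<open>v\<close> in \<open>f\<close> is orthogonal to the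
  rows of \<open>f\<close> at the nonneighbours \<open>N\<close> of \<open>v\<close>, hence almost orthogonal to those of \<open>g\<close>. As the latter
  are independent, uniformly in \<open>g\<close>, its projection \<open>p\<close> onto their span is small, and subtracting
  \<open>p\<close> yields an admissible vector for \<open>v\<close> close to the old one. The condition on \<open>J\<close> concerns earlier
  vertices only and is carried along; \<open>J = {}\<close> makes it void.
\<close>

lemma extend_approximation:
  assumes approx: "regular_reps s \<subseteq> closure (regular_reps t \<inter> {f. rows_independent f J})"
    and st: "set s = set t" and J: "J \<subseteq> set t" and v: "v \<notin> set t"
  shows "regular_reps (v # s) \<subseteq> closure (regular_reps (v # t) \<inter> {f. rows_independent f J})"
proof
  fix f assume f: "f \<in> regular_reps (v # s)"
  define N where "N = nonneighbours v (set s)"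
  define x where "x = f $ v"
  have N: "N \<subseteq> set t" "nonneighbours v (set t) = N" using st by (auto simp: N_def nonneighbours_def)
  from f have fN: "rows_independent f N" and fs: "f \<in> regular_reps s"
    and x: "x \<in> U" "\<And>w. w \<in> N \<Longrightarrow> f $ w \<bullet> x = 0"
    by (auto simp: regular_reps_Cons N_def x_def)
  obtain \<delta> where d: "\<delta> > 0" "\<And>c. \<delta> * (\<Sum>j\<in>N. \<bar>c j\<bar>) \<le> norm (\<Sum>j\<in>N. c j *\<^sub>R f $ j)"
    using independent_family_lower_bound[OF fN] by blast
  show "f \<in> closure (regular_reps (v # t) \<inter> {f. rows_independent f J})"
    unfolding closure_approachable
  proof (intro allI impI)
    fix e :: real assume e: "e > 0"
    \<comment> \<open>An approximation \<open>g\<close> within \<open>\<eta>\<close> leads to one within \<open>\<eta> * K\<close> after correcting row \<open>v\<close>.\<close>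
    define K where "K = 2 + 2 * norm x / \<delta>"
    have K: "K > 0" using d(1) by (simp add: K_def add_pos_nonneg)
    define \<eta> where "\<eta> = min (\<delta> / 2) (e / (2 * K))"
    have eta: "\<eta> > 0" "\<eta> \<le> \<delta> / 2" "\<eta> \<le> e / (2 * K)" using d e K by (auto simp: \<eta>_def)
    then have eta3: "\<eta> * K < e" using K e by (auto simp: field_simps)
    from approx fs eta(1) obtain g where g: "g \<in> regular_reps t" "rows_independent g J" "dist g f < \<eta>"
      unfolding closure_approachable subset_iff by blast
    have gt: "g \<in> ortho_reps (set t)" using g(1) by (simp add: regular_reps_def)
    have fg: "dist f g \<le> \<eta>" using g(3) by (simp add: dist_commute)
    have row: "norm (g $ w - f $ w) \<le> \<eta>" for w
      using Finite_Cartesian_Product.norm_nth_le[of "g - f" w] g(3) by (simp add: dist_norm)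
    have low: "\<delta> / 2 * (\<Sum>j\<in>N. \<bar>c j\<bar>) \<le> norm (\<Sum>j\<in>N. c j *\<^sub>R g $ j)" for c
    proof -
      have "\<delta> / 2 * (\<Sum>j\<in>N. \<bar>c j\<bar>) \<le> (\<delta> - \<eta>) * (\<Sum>j\<in>N. \<bar>c j\<bar>)"
        using eta(2) by (intro mult_right_mono sum_nonneg) auto
      with lower_bound_perturb[OF d(2) fg, of c] show ?thesis by linarith
    qed
    have gN: "rows_independent g N"
      by (rule independent_family_if_lower_bound[OF _ _ low]) (use d(1) in auto)
    obtain p z where pz: "p \<in> span ((\<lambda>w. g $ w) ` N)"
      "\<And>w. w \<in> span ((\<lambda>w. g $ w) ` N) \<Longrightarrow> orthogonal z w" "x = p + z"
      using orthogonal_subspace_decomp_exists[of "(\<lambda>w. g $ w) ` N" x] by blast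
    obtain c where c: "p = (\<Sum>j\<in>N. c j *\<^sub>R g $ j)" using span_image_sum[OF pz(1)] by auto
    have zU: "z \<in> U"
    proof -
      have "p \<in> U" using span_rows_subset[OF gt N(1)] pz(1) by auto
      then show ?thesis using pz(3) x(1) subspace_diff[OF U, of x p] by simp
    qed
    \<comment> \<open>The rows of \<open>f\<close> may be subtracted because \<open>x\<close> is orthogonal to them.\<close>
    have pp: "p \<bullet> p = (\<Sum>j\<in>N. c j * ((g $ j - f $ j) \<bullet> x))"
    proof -
      have "p \<bullet> p = p \<bullet> x" using pz by (simp add: inner_add_right orthogonal_def inner_commute)
      also have "\<dots> = (\<Sum>j\<in>N. c j * (g $ j \<bullet> x))" by (simp add: c inner_sum_left)
      also have "\<dots> = (\<Sum>j\<in>N. c j * ((g $ j - f $ j) \<bullet> x))"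
        using x(2) by (intro sum.cong) (auto simp: inner_diff_left)
      finally show ?thesis .
    qed
    have p: "norm p \<le> 2 * norm x / \<delta> * \<eta>"
    proof (cases "p = 0")
      case False
      have "norm p * norm p = p \<bullet> p" by (simp add: power2_norm_eq_inner[symmetric] power2_eq_square)
      also have "\<dots> \<le> (\<Sum>j\<in>N. \<bar>c j\<bar> * (\<eta> * norm x))"
        unfolding pp
      proof (rule sum_mono)
        fix j
        have "\<bar>(g $ j - f $ j) \<bullet> x\<bar> \<le> \<eta> * norm x"
          using Cauchy_Schwarz_ineq2[of "g $ j - f $ j" x] mult_right_mono[OF row[of j], of "norm x"] by simp
        then have "\<bar>c j * ((g $ j - f $ j) \<bullet> x)\<bar> \<le> \<bar>c j\<bar> * (\<eta> * norm x)"
          by (simp add: abs_mult mult_left_mono)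
        then show "c j * ((g $ j - f $ j) \<bullet> x) \<le> \<bar>c j\<bar> * (\<eta> * norm x)" by linarith
      qed
      also have "\<dots> = (\<Sum>j\<in>N. \<bar>c j\<bar>) * (\<eta> * norm x)" by (simp add: sum_distrib_right)
      also have "\<dots> \<le> (2 / \<delta> * norm p) * (\<eta> * norm x)"
        using low[of c] d(1) eta(1) by (intro mult_right_mono) (auto simp: c field_simps)
      finally have "norm p * norm p \<le> norm p * (2 * norm x / \<delta> * \<eta>)" by (simp add: mult_ac)
      then show ?thesis using False mult_le_cancel_left_pos[of "norm p"] by (metis zero_less_norm_iff)
    qed (use d eta in simp)
    let ?h = "g + axis v (z - g $ v)"
    have h: "?h $ v = z" "\<And>w. w \<noteq> v \<Longrightarrow> ?h $ w = g $ w" by (auto simp: axis_def)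
    have ht: "w \<in> set t \<Longrightarrow> ?h $ w = g $ w" for w using h(2) v by metis
    have "?h \<in> regular_reps t"
      using g(1) ortho_reps_cong[of "set t" ?h g] regular_cong[of t ?h g] ht
      by (auto simp: regular_reps_def)
    moreover have "rows_independent ?h N"
      using gN independent_family_cong[of N "\<lambda>w. ?h $ w" "\<lambda>w. g $ w"] ht N(1) by auto
    moreover have "\<forall>w\<in>N. ?h $ w \<bullet> z = 0"
    proof
      fix w assume "w \<in> N"
      then have "orthogonal z (g $ w)" by (intro pz(2) span_base) auto
      then show "?h $ w \<bullet> z = 0" using ht N(1) \<open>w \<in> N\<close> by (auto simp: orthogonal_def inner_commute)
    qed
    ultimately have "?h \<in> regular_reps (v # t)"
      unfolding regular_reps_Cons N(2) h(1) using zU by blast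
    moreover have "rows_independent ?h J"
      using g(2) independent_family_cong[of J "\<lambda>w. ?h $ w" "\<lambda>w. g $ w"] ht J by auto
    moreover have "dist ?h f < e"
    proof -
      have "?h - f = (g - f) + axis v (z - g $ v)" by simp
      then have "norm (?h - f) \<le> norm (g - f) + norm (z - g $ v)"
        by (metis norm_triangle_ineq norm_axis)
      moreover have "z - g $ v = - p - (g $ v - f $ v)" using pz(3) by (simp add: x_def)
      then have "norm (z - g $ v) \<le> norm p + \<eta>"
        using norm_triangle_ineq4[of "- p" "g $ v - f $ v"] row[of v] norm_minus_cancel[of p]
        by (metis add_left_mono order_trans)
      ultimately have "norm (?h - f) \<le> norm (g - f) + (norm p + \<eta>)" by linarith
      also have "\<dots> \<le> \<eta> * K"
        using p fg by (simp add: K_def algebra_simps dist_norm norm_minus_commute)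
      finally show ?thesis using eta3 by (simp add: dist_norm)
    qed
    ultimately show "\<exists>y\<in>regular_reps (v # t) \<inter> {f. rows_independent f J}. dist y f < e" by blast
  qed
qed

text \<open>
  Moving row \<open>v\<close> along \<open>y\<close> destroys the condition \<open>\<noteq> 0\<close> for at most one step length, so one of two
  small steps succeeds.
\<close>

lemma approximate_by_perturbing_row:
  assumes y: "y \<bullet> b \<noteq> 0"
    and P: "\<And>\<epsilon>. (f $ v + \<epsilon> *\<^sub>R y) \<bullet> b \<noteq> 0 \<Longrightarrow> f + axis v (\<epsilon> *\<^sub>R y) \<in> P"
  shows "(f :: real^'m^'n) \<in> closure P"
  unfolding closure_approachable
proof (intro allI impI)
  fix e :: real assume e: "e > 0"
  have y0: "norm y > 0" using y by auto
  define \<epsilon> where "\<epsilon> = e / (2 * norm y)"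
  have e0: "\<epsilon> > 0" using e y0 by (simp add: \<epsilon>_def)
  obtain \<epsilon>' where e': "\<epsilon>' \<in> {\<epsilon>, \<epsilon> / 2}" "(f $ v + \<epsilon>' *\<^sub>R y) \<bullet> b \<noteq> 0"
  proof (cases "(f $ v + \<epsilon> *\<^sub>R y) \<bullet> b = 0")
    case True
    then have "(f $ v + (\<epsilon> / 2) *\<^sub>R y) \<bullet> b = - ((\<epsilon> / 2) * (y \<bullet> b))"
      by (simp add: inner_add_left)
    then have "(f $ v + (\<epsilon> / 2) *\<^sub>R y) \<bullet> b \<noteq> 0" using e0 y by simp
    then show ?thesis using that by blast
  qed (use that in blast)
  have "dist (f + axis v (\<epsilon>' *\<^sub>R y)) f = \<bar>\<epsilon>'\<bar> * norm y" by (simp add: dist_norm norm_axis)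
  also have "\<dots> \<le> \<epsilon> * norm y" using e'(1) e0 y0 by (intro mult_right_mono) auto
  also have "\<dots> < e" using e y0 by (simp add: \<epsilon>_def)
  finally show "\<exists>g\<in>P. dist g f < e" using P[OF e'(2)] by blast
qed

text \<open>
  While fewer than \<open>dim U\<close> vectors have been chosen, some nonzero \<open>y \<in> U\<close> is orthogonal to all of
  them. Adding a multiple of \<open>y\<close> to the next vector respects every orthogonality condition, and
  all multiples but one put that vector outside the span of its predecessors.
\<close>

lemma approximate_by_independent:
  assumes "distinct s" "length s \<le> dim U"
  shows "regular_reps s \<subseteq> closure (regular_reps s \<inter> {f. rows_independent f (set s)})"
  using assms
proof (induction s)
  case Nil
  then show ?case by (simp add: independent_family_def closure_subset)
next
  case (Cons v s)
  let ?s = "set s"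
  let ?A = "regular_reps (v # s) \<inter> {f. rows_independent f ?s}"
  let ?B = "regular_reps (v # s) \<inter> {f. rows_independent f (set (v # s))}"
  have v: "v \<notin> ?s" and len: "card ?s < dim U" using Cons.prems by (auto simp: distinct_card)
  have "regular_reps (v # s) \<subseteq> closure ?A"
    using Cons v by (intro extend_approximation) auto
  moreover have "?A \<subseteq> closure ?B"
  proof
    fix f assume f: "f \<in> ?A"
    then have "f \<in> regular_reps (v # s)" by simp
    then have fo: "f \<in> ortho_reps ?s" and fU: "f $ v \<in> U" and fs: "f \<in> regular_reps s"
      unfolding regular_reps_Cons by (auto simp: regular_reps_def)
    let ?W = "span ((\<lambda>w. f $ w) ` ?s)"
    have "dim ?W \<le> card ((\<lambda>w. f $ w) ` ?s)" unfolding dim_span by (intro dim_le_card') auto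
    also have "\<dots> \<le> card ?s" by (intro card_image_le) auto
    finally have "dim ?W < dim U" using len by simp
    moreover have "?W \<subseteq> U" by (rule span_rows_subset[OF fo]) auto
    moreover have "span U = U" using U by (simp add: span_eq_iff)
    ultimately have "?W \<subset> span U" by (metis less_irrefl psubsetI)
    then obtain y where y: "y \<noteq> 0" "y \<in> span U" "\<And>x. x \<in> ?W \<Longrightarrow> orthogonal y x"
      by (rule orthogonal_to_subspace_exists_gen) blast
    have yU: "y \<in> U" using y(2) \<open>span U = U\<close> by simp
    have yw: "f $ w \<bullet> y = 0" if "w \<in> ?s" for w
      using y(3)[of "f $ w"] that by (auto simp: orthogonal_def inner_commute span_base)
    show "f \<in> closure ?B"
    proof (rule approximate_by_perturbing_row[of y y f v])
      show "y \<bullet> y \<noteq> 0" using y(1) by simp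
      fix \<epsilon> assume eps: "(f $ v + \<epsilon> *\<^sub>R y) \<bullet> y \<noteq> 0"
      let ?h = "f + axis v (\<epsilon> *\<^sub>R y)"
      have hv: "?h $ v = f $ v + \<epsilon> *\<^sub>R y" by (simp add: axis_def)
      have hw: "?h $ w = f $ w" if "w \<in> ?s" for w using that v by (auto simp: axis_def)
      have hI: "rows_independent ?h I \<longleftrightarrow> rows_independent f I" if "I \<subseteq> ?s" for I
        using that hw by (intro independent_family_cong) blast
      have N: "nonneighbours v ?s \<subseteq> ?s" by (auto simp: nonneighbours_def)
      have "?h \<in> regular_reps s"
        using fs ortho_reps_cong[of ?s ?h f] regular_cong[of s ?h f] hw
        by (auto simp: regular_reps_def)
      moreover have "f $ v + \<epsilon> *\<^sub>R y \<in> U" using fU yU U by (intro subspace_add subspace_scale)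
      moreover have "\<forall>w\<in>nonneighbours v ?s. ?h $ w \<bullet> ?h $ v = 0"
      proof
        fix w assume w: "w \<in> nonneighbours v ?s"
        then have "f $ w \<bullet> f $ v = 0" using f by (auto simp: regular_reps_Cons)
        then show "?h $ w \<bullet> ?h $ v = 0"
          using w N yw[of w] hw[of w] hv by (auto simp: inner_add_right)
      qed
      ultimately have "?h \<in> regular_reps (v # s)"
        using f hI[OF N] hv by (auto simp: regular_reps_Cons)
      moreover have "rows_independent ?h (insert v ?s)"
      proof (rule independent_family_insert)
        show "rows_independent ?h ?s" using f hI by auto
        show "?h $ w \<bullet> y = 0" if "w \<in> ?s" for w using hw yw that by auto
        show "?h $ v \<bullet> y \<noteq> 0" using eps hv by simp
      qed (use v in auto)
      ultimately show "?h \<in> ?B" unfolding Int_iff mem_Collect_eq list.set by blast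
    qed
  qed
  ultimately show ?case by (meson closure_minimal closed_closure order_trans)
qed

lemma independent_imp_regular:
  "rows_independent f (set s) \<Longrightarrow> f \<in> regular s"
proof (induction s)
  case (Cons v s)
  then have "rows_independent f (set s)" by (rule_tac independent_family_mono) auto
  moreover have "rows_independent f (nonneighbours v (set s))"
    using Cons.prems by (rule independent_family_mono) (auto simp: nonneighbours_def)
  ultimately show ?case using Cons.IH by simp
qed simp

lemma closure_regular_reps_extend:
  assumes "closure (regular_reps s) = closure (regular_reps t)" "set s = set t" "v \<notin> set t"
  shows "closure (regular_reps (v # s)) = closure (regular_reps (v # t))"
proof -
  have "regular_reps (v # s) \<subseteq> closure (regular_reps (v # t))"
    if "closure (regular_reps s) = closure (regular_reps t)" "set s = set t" "v \<notin> set t" for s t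
    using extend_approximation[of s t "{}" v] that closure_subset[of "regular_reps s"]
    by (simp add: independent_family_def)
  from this[OF assms] this[of t s] assms show ?thesis
    by (intro antisym closure_minimal) auto
qed

text \<open>
  Neither of two adjacent vertices is a nonneighbour of the other, so the vector of one does not
  constrain the choice for the other.
\<close>

lemma regular_reps_swap:
  assumes "E v w"
  shows "regular_reps (v # w # r) = regular_reps (w # v # r)"
proof -
  have "nonneighbours v (insert w (set r)) = nonneighbours v (set r)"
    "nonneighbours w (insert v (set r)) = nonneighbours w (set r)"
    using assms by (auto simp: nonneighbours_def E_sym)
  then show ?thesis by (auto simp: regular_reps_def insert_commute)
qed

end

section \<open>Graphs without large disconnected parts\<close>

locale highly_connected = orthogonal_representation E U
  for E :: "'n::finite \<Rightarrow> 'n \<Rightarrow> bool" and U :: "(real^'m) set" +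
  assumes disconnected_small: "\<not> induced_connected E T \<Longrightarrow> card T \<le> dim U"
    and dim_pos: "dim U \<ge> 1"
    and irrefl: "\<not> E v v"
begin

text \<open>
  Induction on the number of vertices. Up to \<open>dim U\<close> vertices, both closures are that of the
  independent representations. Beyond that the induced subgraph is connected. By induction and
  extension, the closure is determined by the vertex chosen last (\<open>same_head\<close>); along an edge it does
  not change, since the two ends can be put last in either order; so it is constant along
  paths (\<open>any\<close>).
\<close>

lemma closure_regular_reps_perm:
  assumes "distinct s" "distinct t" "set s = set t"
  shows "closure (regular_reps s) = closure (regular_reps t)"
  using assms
proof (induction "length s" arbitrary: s t rule: less_induct)
  case less
  have len: "length s = length t" using less.prems by (metis distinct_card)
  show ?case
  proof (cases "card (set s) \<le> dim U")
    case True
    have eq: "closure (regular_reps s) =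
        closure (ortho_reps (set s) \<inter> {f. rows_independent f (set s)})"
      if "distinct s" "card (set s) \<le> dim U" for s
    proof (rule antisym)
      have "regular_reps s \<inter> {f. rows_independent f (set s)} =
        ortho_reps (set s) \<inter> {f. rows_independent f (set s)}"
        using independent_imp_regular by (auto simp: regular_reps_def)
      with approximate_by_independent[of s] that
      show "closure (regular_reps s) \<subseteq>
          closure (ortho_reps (set s) \<inter> {f. rows_independent f (set s)})"
        by (intro closure_minimal) (auto simp: distinct_card)
      show "closure (ortho_reps (set s) \<inter> {f. rows_independent f (set s)}) \<subseteq>
          closure (regular_reps s)"
        using independent_imp_regular by (intro closure_mono) (auto simp: regular_reps_def)
    qed
    show ?thesis using eq[of s] eq[of t] True less.prems by simp
  next
    case False
    then have conn: "induced_connected E (set s)" using disconnected_small by blast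
    have same_head: "closure (regular_reps (v # p)) = closure (regular_reps (v # q))"
      if "distinct (v # p)" "distinct (v # q)" "set (v # p) = set s" "set (v # q) = set s" for v p q
    proof (rule closure_regular_reps_extend)
      have pq: "set p = set q" using that by auto
      have "length p < length s"
        using that(1,3) less.prems(1) by (metis distinct_card impossible_Cons not_le_imp_less)
      then show "closure (regular_reps p) = closure (regular_reps q)"
        using less.hyps[of p q] that pq by auto
      show "set p = set q" "v \<notin> set q" using pq that by auto
    qed
    have any: "closure (regular_reps (u # p)) = closure (regular_reps (w # q))"
      if path: "(\<lambda>x y. x \<in> set s \<and> y \<in> set s \<and> E x y)\<^sup>*\<^sup>* u w"
        and p: "distinct (u # p)" "set (u # p) = set s"
        and q: "distinct (w # q)" "set (w # q) = set s" for u w p q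
      using path q
    proof (induction w arbitrary: q rule: rtranclp_induct)
      case base
      then show ?case using same_head p by blast
    next
      case (step y w)
      have yw: "y \<in> set s" "w \<in> set s" "E y w" "y \<noteq> w" using step.hyps irrefl by auto
      obtain r where r: "set r = set s - {y, w}" "distinct r"
        using finite_distinct_list[of "set s - {y, w}"] by auto
      have yr: "distinct (y # w # r)" "set (y # w # r) = set s"
        and wr: "distinct (w # y # r)" "set (w # y # r) = set s" using r yw by auto
      have "closure (regular_reps (u # p)) = closure (regular_reps (y # w # r))"
        using yr by (rule step.IH)
      also have "\<dots> = closure (regular_reps (w # y # r))" by (simp add: regular_reps_swap yw)
      also have "\<dots> = closure (regular_reps (w # q))"
        using wr step.prems by (intro same_head) auto
      finally show ?case .
    qed
    have "s \<noteq> []" "t \<noteq> []" using False len by auto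
    then obtain u p w q where st: "s = u # p" "t = w # q" by (meson neq_Nil_conv)
    then have "u \<in> set s" "w \<in> set s" using less.prems(3) by auto
    then have "(\<lambda>x y. x \<in> set s \<and> y \<in> set s \<and> E x y)\<^sup>*\<^sup>* u w"
      using conn by (simp add: induced_connected_def)
    from any[OF this, of p q] show ?thesis using st less.prems by metis
  qed
qed

text \<open>
  Reorder the vertices so that those of \<open>J\<close> come first: their vectors can be made independent, and
  the others follow by extension. The approximating representations are regular for the new order;
  near a representation that is regular for the old order they are regular for that one too, because
  regularity is an open condition.
\<close>

lemma regular_reps_dense_independent:
  assumes s: "distinct s" and J: "J \<subseteq> set s" "card J \<le> dim U"
  shows "regular_reps s \<subseteq> closure (regular_reps s \<inter> {f. rows_independent f J})"
proof -
  obtain j where j: "set j = J" "distinct j" using finite_distinct_list[of J] by auto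
  obtain r where r: "set r = set s - J" "distinct r" using finite_distinct_list[of "set s - J"] by auto
  have "length j \<le> dim U" using j J(2) by (metis distinct_card)
  then have dense: "regular_reps (q @ j) \<subseteq> closure (regular_reps (q @ j) \<inter> {f. rows_independent f J})"
    if "distinct (q @ j)" for q
    using that
  proof (induction q)
    case Nil
    then show ?case using approximate_by_independent[of j] j by simp
  next
    case (Cons v q)
    have "regular_reps (v # (q @ j)) \<subseteq>
        closure (regular_reps (v # (q @ j)) \<inter> {f. rows_independent f J})"
      using Cons j by (intro extend_approximation) auto
    then show ?case by simp
  qed
  let ?t = "r @ j"
  have t: "distinct ?t" "set ?t = set s" using j r J by auto
  have "regular_reps s \<subseteq> closure (regular_reps ?t)"
    using closure_regular_reps_perm[OF s t(1)] t(2) closure_subset[of "regular_reps s"] by simp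
  also have "\<dots> \<subseteq> closure (regular_reps ?t \<inter> {f. rows_independent f J})"
    using dense[OF t(1)] by (intro closure_minimal) auto
  also have "\<dots> \<subseteq> closure (ortho_reps (set s) \<inter> {f. rows_independent f J})"
    using t(2) by (intro closure_mono) (auto simp: regular_reps_def)
  finally have "regular_reps s \<subseteq>
      regular s \<inter> closure (ortho_reps (set s) \<inter> {f. rows_independent f J})"
    by (auto simp: regular_reps_def)
  also have "\<dots> \<subseteq> closure (regular s \<inter> (ortho_reps (set s) \<inter> {f. rows_independent f J}))"
    by (rule open_Int_closure_subset[OF open_regular])
  also have "regular s \<inter> (ortho_reps (set s) \<inter> {f. rows_independent f J}) =
      regular_reps s \<inter> {f. rows_independent f J}" by (auto simp: regular_reps_def)
  finally show ?thesis .
qed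

text \<open>
  A vertex is isolated in the subgraph induced by itself and its nonneighbours, which therefore has
  at most \<open>dim U\<close> vertices.
\<close>

lemma card_nonneighbours: "card (nonneighbours v T) < dim U"
proof (cases "nonneighbours v T = {}")
  case False
  let ?T = "insert v (nonneighbours v T)"
  obtain w where w: "w \<in> nonneighbours v T" using False by blast
  have "\<not> induced_connected E ?T"
  proof
    assume "induced_connected E ?T"
    then have "(\<lambda>x y. x \<in> ?T \<and> y \<in> ?T \<and> E x y)\<^sup>*\<^sup>* v w" using w by (auto simp: induced_connected_def)
    then show False
    proof (cases rule: converse_rtranclpE)
      case base
      then show False using w by (auto simp: nonneighbours_def)
    next
      case (step y)
      then show False using irrefl by (auto simp: nonneighbours_def)
    qed
  qed
  from disconnected_small[OF this] show ?thesis by (simp add: nonneighbours_def)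
qed (use dim_pos in simp)

text \<open>
  Choosing the zero vector is always orthogonal to what precedes; what has to be ensured is the
  independence of the nonneighbours, which are few enough for the density result.
\<close>

lemma regular_reps_nonempty: "distinct s \<Longrightarrow> regular_reps s \<noteq> {}"
proof (induction s)
  case Nil
  then show ?case by (auto simp: regular_reps_def ortho_reps_def)
next
  case (Cons v s)
  let ?N = "nonneighbours v (set s)"
  have "regular_reps s \<subseteq> closure (regular_reps s \<inter> {f. rows_independent f ?N})"
    using Cons.prems card_nonneighbours[of v "set s"]
    by (intro regular_reps_dense_independent) (auto simp: nonneighbours_def)
  moreover have "regular_reps s \<noteq> {}" using Cons by simp
  ultimately have "regular_reps s \<inter> {f. rows_independent f ?N} \<noteq> {}"
    by (metis closure_empty subset_empty)
  then obtain f where f: "f \<in> regular_reps s" "rows_independent f ?N" by blast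
  let ?h = "f + axis v (- f $ v)"
  have hw: "?h $ w = f $ w" if "w \<in> set s" for w using that Cons.prems by (auto simp: axis_def)
  have "?h $ v = 0" by (simp add: axis_def)
  moreover have "?h \<in> regular_reps s"
    using f ortho_reps_cong[of "set s" ?h f] regular_cong[of s ?h f] hw
    by (auto simp: regular_reps_def)
  moreover have "rows_independent ?h ?N \<longleftrightarrow> rows_independent f ?N"
    by (intro independent_family_cong hw) (auto simp: nonneighbours_def)
  ultimately have "?h \<in> regular_reps (v # s)"
    using f subspace_0[OF U] by (auto simp: regular_reps_Cons)
  then show ?case by blast
qed

text \<open>
  By density it may be assumed that the rows of \<open>b\<close> and of the nonneighbours of \<open>a\<close> are independent.
  Then the component \<open>z\<close> of row \<open>b\<close> orthogonal to the rows of these nonneighbours is nonzero, and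
  row \<open>a\<close> can be moved along \<open>z\<close> with all other rows kept.
\<close>

lemma regular_reps_dense_nonorthogonal:
  assumes s: "distinct s" "set s = UNIV" and ab: "E a b"
  shows "regular_reps s \<subseteq> closure (regular_reps s \<inter> {f. f $ a \<bullet> f $ b \<noteq> 0})"
proof -
  let ?N = "nonneighbours a UNIV"
  let ?P = "{f. f $ a \<bullet> f $ b \<noteq> 0}"
  have bN: "b \<notin> ?N" "a \<notin> ?N" "a \<noteq> b" using ab irrefl by (auto simp: nonneighbours_def)
  have "card (insert b ?N) \<le> dim U"
    using card_nonneighbours[of a UNIV] by (simp add: card_insert_if bN)
  then have "regular_reps s \<subseteq> closure (regular_reps s \<inter> {f. rows_independent f (insert b ?N)})"
    using s by (intro regular_reps_dense_independent) auto
  also have "\<dots> \<subseteq> closure (regular_reps s \<inter> ?P)"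
  proof (intro closure_minimal closed_closure subsetI)
    fix f assume f: "f \<in> regular_reps s \<inter> {f. rows_independent f (insert b ?N)}"
    then have fo: "f \<in> ortho_reps UNIV" and fr: "f \<in> regular s"
      using s(2) by (auto simp: regular_reps_def)
    obtain p z where pz: "p \<in> span ((\<lambda>w. f $ w) ` ?N)"
      "\<And>w. w \<in> span ((\<lambda>w. f $ w) ` ?N) \<Longrightarrow> orthogonal z w" "f $ b = p + z"
      using orthogonal_subspace_decomp_exists[of "(\<lambda>w. f $ w) ` ?N" "f $ b"] by blast
    obtain c where c: "p = (\<Sum>j\<in>?N. c j *\<^sub>R f $ j)" using span_image_sum[OF pz(1)] by auto
    have "z \<noteq> 0"
    proof
      assume "z = 0"
      let ?c = "\<lambda>j. if j = b then -1 else c j"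
      have "(\<Sum>j\<in>?N. ?c j *\<^sub>R f $ j) = p" unfolding c using bN by (intro sum.cong) auto
      then have "(\<Sum>j\<in>insert b ?N. ?c j *\<^sub>R f $ j) = 0" using bN pz(3) \<open>z = 0\<close> by simp
      then show False using f independent_familyD[of "\<lambda>j. f $ j" "insert b ?N" ?c b] by simp
    qed
    then have zb: "z \<bullet> f $ b \<noteq> 0" using pz by (simp add: inner_add_right orthogonal_def)
    have zU: "z \<in> U"
    proof -
      have "p \<in> U" using span_rows_subset[OF fo, of ?N] pz(1) by auto
      moreover have "f $ b \<in> U" using ortho_reps_U[OF fo] by simp
      ultimately show ?thesis using pz(3) subspace_diff[OF U, of "f $ b" p] by simp
    qed
    have zN: "f $ w \<bullet> z = 0" if "w \<in> ?N" for w
      using pz(2)[of "f $ w"] that by (auto simp: orthogonal_def inner_commute span_base)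
    have "f \<in> closure (ortho_reps UNIV \<inter> ?P)"
    proof (rule approximate_by_perturbing_row[of z "f $ b" f a, OF zb])
      fix \<epsilon> assume eps: "(f $ a + \<epsilon> *\<^sub>R z) \<bullet> f $ b \<noteq> 0"
      let ?h = "f + axis a (\<epsilon> *\<^sub>R z)"
      have ha: "?h $ a = f $ a + \<epsilon> *\<^sub>R z" by (simp add: axis_def)
      have hw: "?h $ w = f $ w" if "w \<noteq> a" for w using that by (auto simp: axis_def)
      have UN: "insert a (UNIV - {a}) = UNIV" "nonneighbours a (UNIV - {a}) = ?N"
        by (auto simp: nonneighbours_def)
      have "f \<in> ortho_reps (insert a (UNIV - {a}))" using fo UN by simp
      then have fa: "f \<in> ortho_reps (UNIV - {a})" "f $ a \<in> U" "\<forall>w\<in>?N. f $ w \<bullet> f $ a = 0"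
        unfolding ortho_reps_insert UN(2) by auto
      have "?h \<in> ortho_reps (insert a (UNIV - {a}))"
        unfolding ortho_reps_insert UN(2)
      proof (intro conjI ballI)
        show "?h \<in> ortho_reps (UNIV - {a})"
          using fa(1) ortho_reps_cong[of "UNIV - {a}" ?h f] hw by auto
        show "?h $ a \<in> U" unfolding ha using fa(2) zU U by (intro subspace_add subspace_scale)
        fix w assume w: "w \<in> ?N"
        then have "w \<noteq> a" using bN by auto
        then show "?h $ w \<bullet> ?h $ a = 0"
          unfolding ha hw[OF \<open>w \<noteq> a\<close>] using w fa(3) zN by (simp add: inner_add_right)
      qed
      moreover have "?h $ a \<bullet> ?h $ b \<noteq> 0" unfolding ha using hw[of b] bN(3) eps by simp
      ultimately show "?h \<in> ortho_reps UNIV \<inter> ?P" using UN by simp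
    qed
    then have "f \<in> closure (regular s \<inter> (ortho_reps UNIV \<inter> ?P))"
      using fr open_Int_closure_subset[OF open_regular, of s "ortho_reps UNIV \<inter> ?P"] by blast
    moreover have "regular s \<inter> (ortho_reps UNIV \<inter> ?P) = regular_reps s \<inter> ?P"
      using s(2) by (auto simp: regular_reps_def)
    ultimately show "f \<in> closure (regular_reps s \<inter> ?P)" by simp
  qed
  finally show ?thesis .
qed

end

section \<open>Generic representations\<close>

lemma finite_open_dense_Inter:
  fixes X :: "'a::topological_space set"
  assumes "finite F" "\<And>P. P \<in> F \<Longrightarrow> open P \<and> X \<subseteq> closure (X \<inter> P)"
  shows "X \<subseteq> closure (X \<inter> \<Inter>F)"
  using assms
proof (induction F)
  case empty
  then show ?case by (simp add: closure_subset)
next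
  case (insert P F)
  have o: "open (\<Inter>F)" using insert by (intro open_Inter) auto
  have "X \<inter> \<Inter>F \<subseteq> \<Inter>F \<inter> closure (X \<inter> P)" using insert.prems by auto
  also have "\<dots> \<subseteq> closure (\<Inter>F \<inter> (X \<inter> P))" by (rule open_Int_closure_subset[OF o])
  also have "\<Inter>F \<inter> (X \<inter> P) = X \<inter> \<Inter>(insert P F)" by auto
  finally have "closure (X \<inter> \<Inter>F) \<subseteq> closure (X \<inter> \<Inter>(insert P F))"
    by (intro closure_minimal) auto
  with insert show ?case by blast
qed

lemma (in highly_connected) exists_generic_representation:
  obtains f where "f \<in> ortho_reps UNIV" "\<And>J. card J \<le> dim U \<Longrightarrow> rows_independent f J"
    "\<And>a b. E a b \<Longrightarrow> f $ a \<bullet> f $ b \<noteq> 0"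
proof -
  obtain s :: "'n list" where s: "set s = UNIV" "distinct s"
    using finite_distinct_list[of "UNIV :: 'n set"] by auto
  define F1 where "F1 = (\<lambda>J. {f::real^'m^'n. rows_independent f J}) ` {J. card J \<le> dim U}"
  define F2 where "F2 = (\<lambda>(a,b). {f::real^'m^'n. f $ a \<bullet> f $ b \<noteq> 0}) ` {(a,b). E a b}"
  have "regular_reps s \<subseteq> closure (regular_reps s \<inter> \<Inter>(F1 \<union> F2))"
  proof (rule finite_open_dense_Inter)
    show "finite (F1 \<union> F2)" by (simp add: F1_def F2_def)
    fix P assume "P \<in> F1 \<union> F2"
    then show "open P \<and> regular_reps s \<subseteq> closure (regular_reps s \<inter> P)"
    proof
      assume "P \<in> F1"
      then show ?thesis
        using s regular_reps_dense_independent[of s] by (auto simp: F1_def intro: open_rows_independent)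
    next
      assume "P \<in> F2"
      then obtain a b where "E a b" and P: "P = {f. f $ a \<bullet> f $ b \<noteq> 0}" by (auto simp: F2_def)
      moreover have "open P" unfolding P by (intro open_Collect_neq continuous_intros)
      ultimately show ?thesis using regular_reps_dense_nonorthogonal[OF s(2,1)] by simp
    qed
  qed
  moreover have "regular_reps s \<noteq> {}" using regular_reps_nonempty s by simp
  ultimately have "regular_reps s \<inter> \<Inter>(F1 \<union> F2) \<noteq> {}" by (metis closure_empty subset_empty)
  then obtain f where f: "f \<in> regular_reps s" "f \<in> \<Inter>(F1 \<union> F2)" by blast
  show ?thesis
  proof
    show "f \<in> ortho_reps UNIV" using f(1) s by (simp add: regular_reps_def)
    show "rows_independent f J" if "card J \<le> dim U" for J using f(2) that by (auto simp: F1_def)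
    show "f $ a \<bullet> f $ b \<noteq> 0" if "E a b" for a b using f(2) that by (auto simp: F2_def)
  qed
qed

section \<open>Spark and rank\<close>

lemma columns_dependent_iff:
  "columns_dependent A S \<longleftrightarrow> \<not> independent_family (\<lambda>j. column j A) S"
  by (auto simp: columns_dependent_def independent_family_def)

lemma invertible_iff_columns_independent:
  fixes A :: "real^'n^'n::finite"
  shows "invertible A \<longleftrightarrow> \<not> columns_dependent A UNIV"
proof -
  have "A *v x = (\<Sum>j\<in>UNIV. x $ j *\<^sub>R column j A)" for x
    by (simp add: matrix_mult_sum scalar_mult_eq_scaleR)
  then have "(\<forall>x. A *v x = 0 \<longrightarrow> x = 0) \<longleftrightarrow> independent_family (\<lambda>j. column j A) UNIV"
    unfolding independent_family_def
    by (metis (no_types, lifting) UNIV_I vec_eq_iff vec_lambda_beta sum.cong zero_index)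
  then show ?thesis
    unfolding columns_dependent_iff invertible_left_inverse matrix_left_invertible_ker by simp
qed

lemma spark_eqI:
  fixes A :: "real^'n^'n::finite"
  assumes "k \<le> CARD('n)" "\<And>S. card S \<le> k \<Longrightarrow> \<not> columns_dependent A S"
    and "k < CARD('n) \<Longrightarrow> \<exists>S. card S = k + 1 \<and> columns_dependent A S"
  shows "spark A = k + 1"
proof (cases "k = CARD('n)")
  case True
  then have "\<not> columns_dependent A UNIV" by (intro assms(2)) simp
  then show ?thesis using True by (simp add: spark_def invertible_iff_columns_independent)
next
  case False
  with assms(1) have k: "k < CARD('n)" by simp
  from assms(3)[OF k] obtain S where S: "card S = k + 1" "columns_dependent A S" by blast
  have "columns_dependent A UNIV"
    using S(2) independent_family_mono[of "\<lambda>j. column j A" UNIV S] by (auto simp: columns_dependent_iff)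
  moreover have "(LEAST s. \<exists>S. card S = s \<and> columns_dependent A S) = k + 1"
  proof (rule Least_equality)
    show "\<exists>S. card S = k + 1 \<and> columns_dependent A S" using S by blast
    fix m assume "\<exists>S. card S = m \<and> columns_dependent A S"
    then show "k + 1 \<le> m" using assms(2) by (metis Suc_eq_plus1 not_less_eq_eq)
  qed
  ultimately show ?thesis by (simp add: spark_def invertible_iff_columns_independent)
qed

lemma not_columns_dependent_if_less_spark:
  assumes "card S < spark A" "card S \<le> CARD('n)"
  shows "\<not> columns_dependent (A :: real^'n^'n::finite) S"
proof (cases "invertible A")
  case True
  then show ?thesis
    using independent_family_mono[of "\<lambda>j. column j A" UNIV S]
    by (auto simp: columns_dependent_iff invertible_iff_columns_independent)
next
  case False
  then show ?thesis using assms not_less_Least by (auto simp: spark_def)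
qed

lemma rank_le_if_rows_in_subspace:
  assumes "subspace U" "\<And>i. f $ i \<in> U"
  shows "rank (f :: real^'m^'n) \<le> dim U"
proof -
  have "rows f \<subseteq> U" using assms(2) by (auto simp: rows_def row_def vec_lambda_eta)
  then show ?thesis unfolding row_rank_def by (rule dim_subset)
qed

text \<open>
  A combination \<open>y\<close> of rows of \<open>f\<close> that is annihilated by \<open>f\<close> is orthogonal to every row, hence to
  itself. So the columns of the Gram matrix satisfy the same linear relations as the rows of \<open>f\<close>.
\<close>

lemma gram_columns_independent:
  fixes f :: "real^'m^'n::finite"
  shows "independent_family (\<lambda>j. column j (f ** transpose f)) S \<longleftrightarrow> rows_independent f S"
proof -
  have col: "column j (f ** transpose f) = f *v (f $ j)" for j
    by (simp add: vec_eq_iff column_def matrix_matrix_mult_def transpose_def matrix_vector_mult_def)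
  have "(\<Sum>j\<in>S. c j *\<^sub>R column j (f ** transpose f)) = f *v (\<Sum>j\<in>S. c j *\<^sub>R f $ j)" for c
    by (simp add: col linear_sum[OF matrix_vector_mul_linear] o_def matrix_vector_mult_scaleR)
  moreover have "f *v y = 0 \<longleftrightarrow> y = 0" if y: "y = (\<Sum>j\<in>S. c j *\<^sub>R f $ j)" for y c
  proof
    assume "f *v y = 0"
    then have "f $ j \<bullet> y = 0" for j
      by (metis matrix_vector_mul_component zero_index)
    then have "y \<bullet> y = 0" by (subst (1) y) (simp add: inner_sum_left)
    then show "y = 0" by simp
  qed simp
  ultimately show ?thesis by (simp add: independent_family_def)
qed

lemma card_independent_columns_le_rank:
  assumes "independent_family (\<lambda>j. column j (A :: real^'n^'n::finite)) S"
  shows "card S \<le> rank A"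
proof -
  have "card S = card ((\<lambda>j. column j A) ` S)"
    using independent_family_imp_independent[OF assms] by (simp add: card_image)
  also have "\<dots> \<le> dim (columns A)"
    using independent_family_imp_independent[OF assms]
    by (intro independent_card_le_dim) (auto simp: columns_def)
  finally show ?thesis by (simp add: column_rank_def)
qed

section \<open>Connectivity and matrices\<close>

text \<open>
  For complete graphs both sides hold: no induced subgraph is disconnected, and the connectivity
  \<open>n - 1\<close> is at least \<open>n - k\<close> because \<open>k \<ge> 1\<close>.
\<close>

lemma m_connected_iff:
  assumes "1 \<le> k" "k \<le> CARD('n::finite)"
  shows "m_connected (CARD('n) - k) (E :: 'n \<Rightarrow> 'n \<Rightarrow> bool) \<longleftrightarrow>
    (\<forall>T. \<not> induced_connected E T \<longrightarrow> card T \<le> k)"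
proof (cases "complete_graph E")
  case True
  have "induced_connected E T" for T
    unfolding induced_connected_def
  proof (intro ballI)
    fix u v assume uv: "u \<in> T" "v \<in> T"
    show "(\<lambda>x y. x \<in> T \<and> y \<in> T \<and> E x y)\<^sup>*\<^sup>* u v"
      by (cases "u = v") (use True uv in \<open>auto simp: complete_graph_def\<close>)
  qed
  then show ?thesis using True assms by (simp add: m_connected_def vertex_connectivity_def)
next
  case False
  then obtain u v where uv: "u \<noteq> v" "\<not> E u v" by (auto simp: complete_graph_def)
  have "\<not> induced_connected E {u, v}"
  proof
    assume "induced_connected E {u, v}"
    then have "(\<lambda>x y. x \<in> {u,v} \<and> y \<in> {u,v} \<and> E x y)\<^sup>*\<^sup>* u v" by (simp add: induced_connected_def)
    then have "v = u"
      by (induction rule: rtranclp_induct) (use uv in auto)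
    with uv show False by simp
  qed
  then have ex: "\<exists>m S. card S = m \<and> \<not> induced_connected E (UNIV - S)"
    by (metis Compl_eq_Diff_UNIV double_complement)
  let ?c = "LEAST m. \<exists>S. card S = m \<and> \<not> induced_connected E (UNIV - S)"
  have c: "vertex_connectivity E = ?c" using False by (simp add: vertex_connectivity_def)
  show ?thesis
  proof
    assume m: "m_connected (CARD('n) - k) E"
    show "\<forall>T. \<not> induced_connected E T \<longrightarrow> card T \<le> k"
    proof (intro allI impI)
      fix T assume "\<not> induced_connected E T"
      then have "\<not> induced_connected E (UNIV - (UNIV - T))" by (simp add: double_diff)
      then have "?c \<le> card (UNIV - T)" by (intro Least_le) blast
      also have "\<dots> = CARD('n) - card T" by (intro card_Diff_subset) auto
      finally have "CARD('n) - k \<le> CARD('n) - card T" using m c by (simp add: m_connected_def)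
      moreover have "card T \<le> CARD('n)" by (intro card_mono) auto
      ultimately show "card T \<le> k" using assms by linarith
    qed
  next
    assume T: "\<forall>T. \<not> induced_connected E T \<longrightarrow> card T \<le> k"
    from LeastI_ex[OF ex] obtain S where S: "card S = ?c" "\<not> induced_connected E (UNIV - S)" by blast
    then have "card (UNIV - S) \<le> k" using T by blast
    then have "CARD('n) - card S \<le> k" by (simp add: card_Diff_subset)
    then show "m_connected (CARD('n) - k) E" using S(1) c by (simp add: m_connected_def)
  qed
qed

lemma exists_matrix_if_connected:
  fixes E :: "'n::finite \<Rightarrow> 'n \<Rightarrow> bool"
  assumes "simple_graph E" "1 \<le> k" "k \<le> CARD('n)"
    and disc: "\<And>T. \<not> induced_connected E T \<Longrightarrow> card T \<le> k"
  shows "\<exists>A \<in> sym_matrices E. k = rank A \<and> rank A = spark A - 1"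
proof -
  have "k \<le> dim (UNIV :: (real^'n) set)" using assms(3) by simp
  then obtain U :: "(real^'n) set" where dimU: "subspace U" "dim U = k"
    by (rule choose_subspace_of_subspace)
  have sym: "symp E" and irr: "irreflp E" using assms(1) by (auto simp: simple_graph_def)
  interpret highly_connected E U
    using sym irr dimU disc assms(2) by unfold_locales (auto simp: irreflp_def)
  obtain f where f: "f \<in> ortho_reps UNIV" "\<And>J. card J \<le> dim U \<Longrightarrow> rows_independent f J"
    "\<And>a b. E a b \<Longrightarrow> f $ a \<bullet> f $ b \<noteq> 0" using exists_generic_representation by blast
  define A where "A = f ** transpose f"
  have entry: "A $ i $ j = f $ i \<bullet> f $ j" for i j
    by (simp add: A_def matrix_matrix_mult_def transpose_def inner_vec_def)
  have AE: "A \<in> sym_matrices E"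
  proof -
    have "transpose A = A" by (simp add: A_def matrix_transpose_mul)
    moreover have "A $ i $ j \<noteq> 0 \<longleftrightarrow> E i j" if "i \<noteq> j" for i j
      using f(1,3) that by (auto simp: entry ortho_reps_def)
    ultimately show ?thesis by (simp add: sym_matrices_def)
  qed
  have cols: "columns_dependent A S \<longleftrightarrow> \<not> rows_independent f S" for S
    by (simp add: columns_dependent_iff A_def gram_columns_independent)
  have fU: "f $ i \<in> U" for i using f(1) by (simp add: ortho_reps_def)
  have "spark A = k + 1"
  proof (rule spark_eqI[OF assms(3)])
    show "\<not> columns_dependent A S" if "card S \<le> k" for S using f(2) that dimU(2) by (simp add: cols)
    assume "k < CARD('n)"
    then obtain S :: "'n set" where S: "card S = k + 1"
      using obtain_subset_with_card_n[of "k + 1" "UNIV :: 'n set"] by auto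
    have "\<not> rows_independent f S"
    proof
      assume ind: "rows_independent f S"
      have "card ((\<lambda>j. f $ j) ` S) \<le> dim U"
        using independent_family_imp_independent[OF ind] fU by (intro independent_card_le_dim) auto
      then show False using independent_family_imp_independent[OF ind] S dimU(2) by (simp add: card_image)
    qed
    with S show "\<exists>S. card S = k + 1 \<and> columns_dependent A S" by (auto simp: cols)
  qed
  moreover have "rank A = k"
  proof (rule antisym)
    have "rank A \<le> rank f" unfolding A_def by (rule rank_mul_le_left)
    also have "\<dots> \<le> k" using rank_le_if_rows_in_subspace[OF dimU(1)] fU dimU(2) by blast
    finally show "rank A \<le> k" .
    obtain S :: "'n set" where S: "card S = k" using obtain_subset_with_card_n[OF assms(3)] by auto
    then have "\<not> columns_dependent A S" using f(2) dimU(2) by (simp add: cols)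
    then show "k \<le> rank A" using card_independent_columns_le_rank[of A S] S by (simp add: columns_dependent_iff)
  qed
  ultimately show ?thesis using AE by force
qed

text \<open>One side consists of the vertices reachable from a vertex that cannot reach all of \<open>T\<close>.\<close>

lemma disconnected_split:
  assumes "symp E" "\<not> induced_connected E T"
  obtains T1 T2 where "T1 \<noteq> {}" "T2 \<noteq> {}" "T1 \<inter> T2 = {}" "T1 \<union> T2 = T"
    "\<And>x y. x \<in> T1 \<Longrightarrow> y \<in> T2 \<Longrightarrow> \<not> E x y"
proof -
  let ?R = "\<lambda>x y. x \<in> T \<and> y \<in> T \<and> E x y"
  from assms(2) obtain u v where uv: "u \<in> T" "v \<in> T" "\<not> ?R\<^sup>*\<^sup>* u v"
    by (auto simp: induced_connected_def)
  let ?T1 = "{x\<in>T. ?R\<^sup>*\<^sup>* u x}"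
  have "\<not> E x y" if "x \<in> ?T1" "y \<in> T - ?T1" for x y
    using that by (auto intro: rtranclp.rtrancl_into_rtrancl)
  then show ?thesis using uv by (intro that[of ?T1 "T - ?T1"]) auto
qed

text \<open>
  The set \<open>W\<close> has one element more than the rank, so its columns are dependent, while all its proper
  subsets have independent columns. In a relation \<open>c\<close> on \<open>W\<close>, the partial sum \<open>y\<close> over one side has zero
  entries at the rows of \<open>W\<close> on the other side, there being no edges across; as \<open>y\<close> is
  also minus the partial sum over the other side, its remaining entries at rows of \<open>W\<close> are zero too.
\<close>

lemma disconnected_small_if_matrix:
  fixes E :: "'n::finite \<Rightarrow> 'n \<Rightarrow> bool"
  assumes "symp E" "1 \<le> k" and A: "A \<in> sym_matrices E" "rank A = k" "spark A = k + 1"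
    and T: "\<not> induced_connected E T"
  shows "card T \<le> k"
proof (rule ccontr)
  assume big: "\<not> card T \<le> k"
  have small: "\<not> columns_dependent A S" if "card S \<le> k" for S
    using that A(3) card_mono[of UNIV S] by (intro not_columns_dependent_if_less_spark) auto
  obtain T1 T2 where T12: "T1 \<noteq> {}" "T2 \<noteq> {}" "T1 \<inter> T2 = {}" "T1 \<union> T2 = T"
    "\<And>x y. x \<in> T1 \<Longrightarrow> y \<in> T2 \<Longrightarrow> \<not> E x y"
    using disconnected_split[OF assms(1) T] by metis
  obtain a b where ab: "a \<in> T1" "b \<in> T2" using T12 by blast
  have "a \<noteq> b" using ab T12 by auto
  have "card {a, b} \<le> k + 1" using assms(2) \<open>a \<noteq> b\<close> by simp
  then obtain W where W: "{a, b} \<subseteq> W" "W \<subseteq> T" "card W = k + 1"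
    using exists_subset_between[of "{a,b}" "k + 1" T] big ab T12(4) by auto
  have entry: "A $ i $ j = 0" if "i \<in> T1 \<and> j \<in> T2 \<or> i \<in> T2 \<and> j \<in> T1" for i j
  proof -
    have "\<not> E i j" using that T12(5) assms(1) by (auto dest: sympD)
    moreover have "i \<noteq> j" using that T12(3) by auto
    ultimately show ?thesis using A(1) by (auto simp: sym_matrices_def)
  qed
  have Asym: "A $ i $ j = A $ j $ i" for i j
    using A(1) by (metis (mono_tags, lifting) mem_Collect_eq sym_matrices_def transpose_def vec_lambda_beta)
  have "columns_dependent A W"
    using card_independent_columns_le_rank[of A W] W(3) A(2) by (auto simp: columns_dependent_iff)
  then obtain c where c: "\<exists>j\<in>W. c j \<noteq> 0" "(\<Sum>j\<in>W. c j *\<^sub>R column j A) = 0"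
    by (auto simp: columns_dependent_def)
  have nz: "c j \<noteq> 0" if "j \<in> W" for j
  proof
    assume "c j = 0"
    then have "(\<Sum>j\<in>W - {j}. c j *\<^sub>R column j A) = 0" using c(2) that by (simp add: sum.remove)
    moreover have "\<exists>i\<in>W - {j}. c i \<noteq> 0" using c(1) \<open>c j = 0\<close> by auto
    ultimately have "columns_dependent A (W - {j})" by (auto simp: columns_dependent_def)
    then show False using small[of "W - {j}"] W(3) that by simp
  qed
  define y where "y = (\<Sum>j\<in>W \<inter> T1. c j *\<^sub>R column j A)"
  have "W = (W \<inter> T1) \<union> (W \<inter> T2)" using W(2) T12(4) by auto
  then have "(\<Sum>j\<in>W. c j *\<^sub>R column j A) = y + (\<Sum>j\<in>W \<inter> T2. c j *\<^sub>R column j A)"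
    unfolding y_def using T12(3) by (subst sum.union_disjoint[symmetric]) auto
  then have y2: "y = - (\<Sum>j\<in>W \<inter> T2. c j *\<^sub>R column j A)"
    using c(2) by (simp add: eq_neg_iff_add_eq_0)
  have yW: "y $ i = 0" if "i \<in> W" for i
  proof (cases "i \<in> T1")
    case True
    then show ?thesis unfolding y2 by (auto simp: column_def entry intro!: sum.neutral)
  next
    case False
    then have "i \<in> T2" using that W(2) T12(4) by auto
    then show ?thesis unfolding y_def by (auto simp: column_def entry intro!: sum.neutral)
  qed
  \<comment> \<open>By symmetry, entry \<open>i\<close> of \<open>y\<close> is a linear function of column \<open>i\<close>, so it vanishes on the span of
    the columns in \<open>W - {a}\<close>, which is the whole column space.\<close>
  let ?d = "\<chi> j. if j \<in> W \<inter> T1 then c j else 0"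
  have yd: "y $ i = column i A \<bullet> ?d" for i
  proof -
    have "column i A \<bullet> ?d = (\<Sum>j\<in>UNIV. A $ j $ i * (if j \<in> W \<inter> T1 then c j else 0))"
      by (simp add: inner_vec_def column_def)
    also have "\<dots> = (\<Sum>j\<in>W \<inter> T1. A $ j $ i * c j)" by (intro sum.mono_neutral_cong_right) auto
    also have "\<dots> = y $ i" by (simp add: y_def column_def Asym[of i] mult.commute)
    finally show ?thesis by simp
  qed
  have "y = 0"
  proof -
    have card: "card (W - {a}) = k" using W by simp
    have ind: "independent_family (\<lambda>j. column j A) (W - {a})"
      using small[of "W - {a}"] card by (simp add: columns_dependent_iff)
    let ?C = "(\<lambda>j. column j A) ` (W - {a})"
    have "card ?C = k" "independent ?C"
      using independent_family_imp_independent[OF ind] card by (auto simp: card_image)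
    moreover have "?C \<subseteq> columns A" by (auto simp: columns_def)
    ultimately have "columns A \<subseteq> span ?C"
      using A(2) by (intro card_ge_dim_independent) (auto simp: column_rank_def)
    moreover have "x \<bullet> ?d = 0" if "x \<in> span ?C" for x
      using that
    proof (induction rule: span_induct_alt)
      case (step c x y)
      then obtain j where "j \<in> W" "x = column j A" by blast
      then have "x \<bullet> ?d = 0" using yW[of j] yd[of j] by simp
      then show ?case using step by (simp add: inner_add_left)
    qed simp
    ultimately have "column i A \<bullet> ?d = 0" for i by (auto simp: columns_def)
    then show ?thesis using yd by (simp add: vec_eq_iff)
  qed
  then have "columns_dependent A (W \<inter> T1)"
    unfolding columns_dependent_def y_def using ab W nz by blast
  moreover have "card (W \<inter> T1) \<le> k"
  proof -
    have "W \<inter> T1 \<subset> W" using W(1) ab T12(3) by auto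
    then have "card (W \<inter> T1) < card W" by (intro psubset_card_mono) auto
    then show ?thesis using W(3) by simp
  qed
  ultimately show False using small by blast
qed

theorem theorem4p3:
  fixes E :: "'n::finite \<Rightarrow> 'n \<Rightarrow> bool" and k :: nat
  assumes "simple_graph E"
    and "connected_graph E"
    and "\<forall>v. \<not> isolated_vertex E v"
    and "1 \<le> k" and "k \<le> CARD('n)"
  shows "m_connected (CARD('n) - k) E \<longleftrightarrow>
    (\<exists>A \<in> sym_matrices E. k = rank A \<and> rank A = spark A - 1)"
proof
  assume "m_connected (CARD('n) - k) E"
  then show "\<exists>A \<in> sym_matrices E. k = rank A \<and> rank A = spark A - 1"
    using exists_matrix_if_connected[OF assms(1,4,5)] m_connected_iff[OF assms(4,5)] by blast
next
  assume "\<exists>A \<in> sym_matrices E. k = rank A \<and> rank A = spark A - 1"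
  then obtain A where A: "A \<in> sym_matrices E" "rank A = k" "spark A = k + 1"
    using assms(4) by force
  have "symp E" using assms(1) by (simp add: simple_graph_def)
  from disconnected_small_if_matrix[OF this assms(4) A]
  show "m_connected (CARD('n) - k) E" unfolding m_connected_iff[OF assms(4,5)] by blast
qed

end
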